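(* Let $m,n\ge0$ be integers. The number of $(m,n)$-singletons, i.e. of binary $m$-painted $n$-trees $\mathbb{T}$ such that no other binary $m$-painted $n$-tree has the same shadow as $\mathbb{T}$, is $$m!\sum_{k=0}^{n}\binom{m+k-1}{k}\,\mathsf{Fib}_{n-k+1},$$ where $\mathsf{Fib}_k$ denotes the $k$-th Fibonacci number, with $\mathsf{Fib}_0=0$, $\mathsf{Fib}_1=1$ and $\mathsf{Fib}_{k+2}=\mathsf{Fib}_{k+1}+\mathsf{Fib}_k$ (and, for $m=0$, $\binom{-1}{0}=1$ and $\binom{k-1}{k}=0$ for $k\ge1$).
   Context: Write $[k]=\{1,\dots,k\}$. **Painted trees.** An $n$-tree is a rooted plane tree with $n+1$ leaves, drawn growing downward from its root; "node" means internal node (leaves excluded), and unary nodes are allowed. A cut of an $n$-tree $T$ is a set of nodes of $T$ containing exactly one node on the path from the root to each leaf. A cut $c$ is below a cut $c'$ if, along any path from the root to a leaf, the node of $c$ is (strictly) after the node of $c'$. An $m$-painted $n$-tree $\mathbb{T}=(T,C,\mu)$ is an $n$-tree $T$ with a sequence $C=(c_1,\dots,c_k)$ of cuts of $T$, with $c_i$ below $c_{i+1}$ for all $i\in[k-1]$, such that $\bigcup C=c_1\cup\dots\cup c_k$ contains all unary nodes of $T$, and an ordered partition $\mu=(\mu_1,\dots,\mu_k)$ of $[m]$ into $k$ nonempty parts ($1\le k\le m$, or $k=0$ if $m=0$); $\mu_i$ is the label of $c_i$. It is binary if $k=m$, all nodes in $\bigcup C$ are unary and all nodes not in $\bigcup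 C$ are binary. **Shadow.** The right branch of $T$ is the path from the root to the rightmost leaf. The shadow $\mathrm{Sh}(\mathbb{T})$ of $\mathbb{T}=(T,C,\mu)$ is the pair of sequences indexed by the nodes of the right branch from the root downward, whose $i$-th terms are respectively the tuple $(n_1,\dots,n_{p-1})$, where $n_1,\dots,n_p$ are the numbers of leaves of the subtrees, from left to right, of the $i$-th node of the right branch, and the label of the cut of $C$ containing this node ($\varnothing$ if there is none). *)

theory Defs
  imports "HOL-Library.Sublist" "HOL-Library.Disjoint_Sets" "HOL-Number_Theory.Fib"
begin

text \<open>Rooted plane trees: a vertex without children is a leaf, any other vertex is a node.
  A vertex is addressed by the list of child indices (counted from 0, left to right) on the way to
  it from the root, so that ancestors of a vertex are prefixes of its address.\<close>

datatype ptree = Tree (children: "ptree list")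

fun subtree :: "ptree \<Rightarrow> nat list \<Rightarrow> ptree option" where
  "subtree t [] = Some t"
| "subtree (Tree ts) (i # p) = (if i < length ts then subtree (ts ! i) p else None)"

definition arity :: "ptree \<Rightarrow> nat list \<Rightarrow> nat" where
  "arity t p = length (children (the (subtree t p)))"

definition leaves :: "ptree \<Rightarrow> nat list set" where
  "leaves t = {p. subtree t p = Some (Tree [])}"

definition nodes :: "ptree \<Rightarrow> nat list set" where
  "nodes t = {p. \<exists>ts. subtree t p = Some (Tree ts) \<and> ts \<noteq> []}"

definition is_cut :: "ptree \<Rightarrow> nat list set \<Rightarrow> bool" where
  "is_cut t c \<longleftrightarrow> c \<subseteq> nodes t \<and> (\<forall>l\<in>leaves t. \<exists>!p. p \<in> c \<and> prefix p l)"

definition cut_below :: "ptree \<Rightarrow> nat list set \<Rightarrow> nat list set \<Rightarrow> bool" where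
  "cut_below t c c' \<longleftrightarrow>
    (\<forall>l\<in>leaves t. \<forall>p\<in>c. \<forall>p'\<in>c'. prefix p l \<longrightarrow> prefix p' l \<longrightarrow> strict_prefix p' p)"

definition ordered_partition :: "'a set \<Rightarrow> 'a set list \<Rightarrow> bool" where
  "ordered_partition A \<mu> \<longleftrightarrow> distinct \<mu> \<and> partition_on A (set \<mu>)"

text \<open>The triple \<open>(t, C, \<mu>)\<close>; the lists \<open>C\<close> and \<open>\<mu>\<close> are indexed from 0, lowest cut first.\<close>

type_synonym painted = "ptree \<times> nat list set list \<times> nat set list"

fun painted_tree :: "nat \<Rightarrow> nat \<Rightarrow> painted \<Rightarrow> bool" where
  "painted_tree m n (t, C, \<mu>) \<longleftrightarrow>
     card (leaves t) = n + 1 \<and>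
     (\<forall>c\<in>set C. is_cut t c) \<and>
     (\<forall>i. Suc i < length C \<longrightarrow> cut_below t (C ! i) (C ! Suc i)) \<and>
     (\<forall>p\<in>nodes t. arity t p = 1 \<longrightarrow> p \<in> \<Union>(set C)) \<and>
     length \<mu> = length C \<and>
     ordered_partition {1..m} \<mu>"

fun binary_painted_tree :: "nat \<Rightarrow> nat \<Rightarrow> painted \<Rightarrow> bool" where
  "binary_painted_tree m n (t, C, \<mu>) \<longleftrightarrow>
     painted_tree m n (t, C, \<mu>) \<and>
     length C = m \<and>
     (\<forall>p\<in>nodes t. if p \<in> \<Union>(set C) then arity t p = 1 else arity t p = 2)"

function right_branch :: "ptree \<Rightarrow> nat list list" where
  "right_branch (Tree ts) =
     (if ts = [] then [] else [] # map (Cons (length ts - 1)) (right_branch (last ts)))"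
  by pat_completeness auto
termination
  by (relation "measure size") (auto simp: less_Suc_eq_le intro: size_list_estimation'[OF last_in_set])

text \<open>The index in the definite description is unique, since the cuts of a painted tree are
  pairwise disjoint.\<close>

definition label_at :: "nat set list \<Rightarrow> nat list set list \<Rightarrow> nat list \<Rightarrow> nat set" where
  "label_at \<mu> C p =
     (if p \<in> \<Union>(set C) then \<mu> ! (THE i. i < length C \<and> p \<in> C ! i) else {})"

fun shadow :: "painted \<Rightarrow> nat list list \<times> nat set list" where
  "shadow (t, C, \<mu>) =
     (map (\<lambda>p. map (\<lambda>s. card (leaves s)) (butlast (children (the (subtree t p))))) (right_branch t),
      map (label_at \<mu> C) (right_branch t))"

definition singletons :: "nat \<Rightarrow> nat \<Rightarrow> painted set" where
  "singletons m n = {T. binary_painted_tree m n T \<and>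
     (\<forall>T'. binary_painted_tree m n T' \<and> shadow T' = shadow T \<longrightarrow> T' = T)}"

end

theory Submission
  imports Defs "HOL-Combinatorics.Multiset_Permutations"
begin

text \<open>In a binary painted tree every path from the root to a leaf crosses the \<open>m\<close> cuts in unary nodes,
  so the tree determines its cuts, and the shadow amounts to the ordered partition together with the
  word that records, along the right branch, \<open>0\<close> for a unary node and the number of leaves of the left
  subtree for a binary node. The tree is a singleton iff every left subtree hanging off the right
  branch is determined by its number of leaves and the number of cuts through it, i.e. iff it is a
  path or, when no cut passes below its parent, a cherry. Removing the root node gives
  \<open>f (m + 1) (n + 1) = f m (n + 1) + f (m + 1) n\<close> and the Fibonacci recurrence for \<open>f 0\<close>, where
  \<open>f m n\<close> is the number of these trees. The formula satisfies the same recurrences, by Pascal's rule.\<close>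

section \<open>Leaves and nodes of plane trees\<close>

lemma arity_simps [simp]:
  "arity (Tree ts) [] = length ts"
  "i < length ts \<Longrightarrow> arity (Tree ts) (i # p) = arity (ts ! i) p"
  by (simp_all add: arity_def)

lemma Nil_in_leaves [simp]: "[] \<in> leaves (Tree ts) \<longleftrightarrow> ts = []"
  and Cons_in_leaves [simp]: "i # p \<in> leaves (Tree ts) \<longleftrightarrow> i < length ts \<and> p \<in> leaves (ts ! i)"
  and Nil_in_nodes [simp]: "[] \<in> nodes (Tree ts) \<longleftrightarrow> ts \<noteq> []"
  and Cons_in_nodes [simp]: "i # p \<in> nodes (Tree ts) \<longleftrightarrow> i < length ts \<and> p \<in> nodes (ts ! i)"
  by (auto simp: leaves_def nodes_def)

lemma leaves_nonempty: "\<exists>l. l \<in> leaves t"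
proof (induction t)
  case (Tree ts)
  show ?case
  proof (cases ts)
    case Nil
    then show ?thesis by (intro exI[of _ "[]"]) simp
  next
    case (Cons s ss)
    then obtain l where "l \<in> leaves (ts ! 0)" using Tree[of s] by auto
    then have "0 # l \<in> leaves (Tree ts)" using Cons by simp
    then show ?thesis by blast
  qed
qed

text \<open>Cuts are constrained only along paths to leaves; this lets the constraints reach every
  node.\<close>

lemma leaf_below_node: "p \<in> nodes t \<Longrightarrow> \<exists>l\<in>leaves t. prefix p l"
proof (induction p arbitrary: t)
  case Nil
  then show ?case using leaves_nonempty by auto
next
  case (Cons i p)
  obtain ts where t: "t = Tree ts" by (cases t)
  with Cons.prems obtain l where "l \<in> leaves (ts ! i)" "prefix p l" using Cons.IH by auto
  then have "i # l \<in> leaves t" "prefix (i # p) (i # l)" using Cons.prems t by auto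
  then show ?case by blast
qed

lemma leaves_Tree: "leaves (Tree ts) = (if ts = [] then {[]} else (\<Union>i<length ts. (#) i ` leaves (ts ! i)))"
proof (rule set_eqI)
  fix l show "l \<in> leaves (Tree ts) \<longleftrightarrow> l \<in> (if ts = [] then {[]} else (\<Union>i<length ts. (#) i ` leaves (ts ! i)))"
    by (cases l) auto
qed

lemma finite_leaves [simp]: "finite (leaves t)"
  by (induction t) (auto simp: leaves_Tree)

lemma leaves_neq_empty [simp]: "leaves t \<noteq> {}"
  using leaves_nonempty[of t] by blast

lemma card_leaves_pos: "card (leaves t) > 0"
  by (simp add: card_gt_0_iff)

lemma ball_leaves_Tree:
  "ts \<noteq> [] \<Longrightarrow> (\<forall>l\<in>leaves (Tree ts). Q l) \<longleftrightarrow> (\<forall>i<length ts. \<forall>l\<in>leaves (ts ! i). Q (i # l))"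
  by (auto simp: leaves_Tree)

lemma card_leaves_simps [simp]:
  "card (leaves (Tree [])) = 1"
  "card (leaves (Tree [s])) = card (leaves s)"
  "card (leaves (Tree [a, b])) = card (leaves a) + card (leaves b)"
proof -
  show "card (leaves (Tree [])) = 1" by (simp add: leaves_Tree)
  have "leaves (Tree [s]) = (#) 0 ` leaves s" by (auto simp: leaves_Tree)
  then show "card (leaves (Tree [s])) = card (leaves s)" by (simp add: card_image)
  have "{..<Suc (Suc 0)} = {0, 1}" by auto
  then have "leaves (Tree [a, b]) = (#) 0 ` leaves a \<union> (#) 1 ` leaves b" by (simp add: leaves_Tree)
  moreover have "((#) 0 ` leaves a) \<inter> ((#) 1 ` leaves b) = {}" by auto
  ultimately show "card (leaves (Tree [a, b])) = card (leaves a) + card (leaves b)"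
    by (simp add: card_Un_disjoint card_image)
qed

lemma ball_nodes_Tree:
  assumes "ts \<noteq> []"
  shows "(\<forall>p\<in>nodes (Tree ts). Q p) \<longleftrightarrow> Q [] \<and> (\<forall>i<length ts. \<forall>p\<in>nodes (ts ! i). Q (i # p))"
  using assms by (metis Cons_in_nodes Nil_in_nodes list.exhaust)

section \<open>Cuts and their traces on the subtrees of the root\<close>

definition restrict_child :: "nat \<Rightarrow> nat list set \<Rightarrow> nat list set" where
  "restrict_child i c = {p. i # p \<in> c}"

lemma in_restrict_child [simp]: "p \<in> restrict_child i c \<longleftrightarrow> i # p \<in> c"
  by (simp add: restrict_child_def)

text \<open>Every node lies on the path to some leaf, and on that path the root is already the
  unique node of the cut.\<close>

lemma is_cut_Nil_in:
  assumes "[] \<in> c"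
  shows "is_cut (Tree ts) c \<longleftrightarrow> ts \<noteq> [] \<and> c = {[]}"
proof
  assume cut: "is_cut (Tree ts) c"
  have "p = []" if "p \<in> c" for p
  proof -
    have "p \<in> nodes (Tree ts)" using cut \<open>p \<in> c\<close> by (auto simp: is_cut_def)
    then obtain l where "l \<in> leaves (Tree ts)" "prefix p l" using leaf_below_node by blast
    then show ?thesis using cut \<open>p \<in> c\<close> assms unfolding is_cut_def by (metis Nil_prefix)
  qed
  moreover have "ts \<noteq> []" using cut assms by (auto simp: is_cut_def)
  ultimately show "ts \<noteq> [] \<and> c = {[]}" using assms by blast
next
  assume "ts \<noteq> [] \<and> c = {[]}"
  then show "is_cut (Tree ts) c" by (auto simp: is_cut_def)
qed

text \<open>A path to a leaf continues in a single child, so the condition splits over the children.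
  The first conjunct excludes addresses that no \<open>restrict_child i\<close> with
  \<open>i < length ts\<close> would see.\<close>

lemma is_cut_Nil_notin:
  assumes "[] \<notin> c" "ts \<noteq> []"
  shows "is_cut (Tree ts) c \<longleftrightarrow>
    (\<forall>p\<in>c. p \<noteq> [] \<and> hd p < length ts) \<and> (\<forall>i<length ts. is_cut (ts ! i) (restrict_child i c))"
proof -
  have nodes: "c \<subseteq> nodes (Tree ts) \<longleftrightarrow>
    (\<forall>p\<in>c. p \<noteq> [] \<and> hd p < length ts) \<and> (\<forall>i<length ts. restrict_child i c \<subseteq> nodes (ts ! i))"
    (is "_ \<longleftrightarrow> ?R")
  proof
    assume c: "c \<subseteq> nodes (Tree ts)"
    then have "p \<noteq> [] \<and> hd p < length ts" if "p \<in> c" for p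
      using that assms by (cases p) (auto dest: subsetD)
    then show ?R using c by (auto dest: subsetD)
  next
    assume R: ?R
    show "c \<subseteq> nodes (Tree ts)"
    proof
      fix p assume p: "p \<in> c"
      then show "p \<in> nodes (Tree ts)" using R by (cases p) (auto 4 4 simp: subset_iff)
    qed
  qed
  have ex1: "(\<exists>!p. p \<in> c \<and> prefix p (i # l)) \<longleftrightarrow> (\<exists>!p. p \<in> restrict_child i c \<and> prefix p l)" for i l
  proof -
    \<comment> \<open>As \<open>[]\<close> is not in \<open>c\<close>, the prefixes of
      \<open>i # l\<close> in \<open>c\<close> all start with \<open>i\<close>, and
      \<open>(#) i\<close> is injective.\<close>
    have "{p. p \<in> c \<and> prefix p (i # l)} = (#) i ` {p. p \<in> restrict_child i c \<and> prefix p l}"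
    proof (rule set_eqI)
      fix p show "p \<in> {p. p \<in> c \<and> prefix p (i # l)} \<longleftrightarrow> p \<in> (#) i ` {p. p \<in> restrict_child i c \<and> prefix p l}"
        using assms(1) by (cases p) auto
    qed
    then have "is_singleton {p. p \<in> c \<and> prefix p (i # l)} \<longleftrightarrow>
        is_singleton {p. p \<in> restrict_child i c \<and> prefix p l}"
      by (simp add: is_singleton_altdef card_image)
    then show ?thesis by (simp add: is_singleton_iff_ex1)
  qed
  show ?thesis unfolding is_cut_def nodes ball_leaves_Tree[OF assms(2)] ex1
    by (simp only: imp_conjR all_conj_distrib conj_assoc)
qed

lemma cut_below_Nil_notin:
  assumes "[] \<notin> c" "[] \<notin> c'" "ts \<noteq> []"
  shows "cut_below (Tree ts) c c' \<longleftrightarrow>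
    (\<forall>i<length ts. cut_below (ts ! i) (restrict_child i c) (restrict_child i c'))"
proof -
  have restrict: "(\<forall>p\<in>d. prefix p (i # l) \<longrightarrow> Q p) \<longleftrightarrow> (\<forall>p\<in>restrict_child i d. prefix p l \<longrightarrow> Q (i # p))"
    if "[] \<notin> d" for d i l and Q :: "nat list \<Rightarrow> bool"
    using that by (auto simp: prefix_Cons)
  have swap: "(\<forall>p\<in>d. \<forall>p'\<in>d'. prefix p l \<longrightarrow> prefix p' l \<longrightarrow> strict_prefix p' p) \<longleftrightarrow>
    (\<forall>p\<in>d. prefix p l \<longrightarrow> (\<forall>p'\<in>d'. prefix p' l \<longrightarrow> strict_prefix p' p))"
    for d d' and l :: "nat list" by blast
  show ?thesis
    unfolding cut_below_def ball_leaves_Tree[OF assms(3)] swap restrict[OF assms(1)] restrict[OF assms(2)]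
    by simp
qed

lemma cut_below_root: "[] \<notin> c \<Longrightarrow> cut_below t c {[]}"
  by (auto simp: cut_below_def strict_prefix_def)

lemma not_cut_below_root:
  assumes "is_cut t c'" shows "\<not> cut_below t {[]} c'"
proof -
  obtain l where l: "l \<in> leaves t" using leaves_nonempty by blast
  with assms obtain p where "p \<in> c'" "prefix p l" unfolding is_cut_def by blast
  with l show ?thesis by (auto simp: cut_below_def)
qed

section \<open>Binary painted trees, decomposed at the root\<close>

text \<open>Isolates the conditions that involve neither sizes nor labels, since these pass to the
  subtrees of the root.\<close>

definition binary_cuts :: "ptree \<Rightarrow> nat list set list \<Rightarrow> bool" where
  "binary_cuts t C \<longleftrightarrow> (\<forall>c\<in>set C. is_cut t c) \<and> successively (cut_below t) C \<and>
     (\<forall>p\<in>nodes t. arity t p = (if p \<in> \<Union>(set C) then 1 else 2))"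

lemma binary_painted_tree_iff:
  "binary_painted_tree m n (t, C, \<mu>) \<longleftrightarrow>
     card (leaves t) = n + 1 \<and> length C = m \<and> binary_cuts t C \<and>
     length \<mu> = m \<and> ordered_partition {1..m} \<mu>"
  unfolding binary_painted_tree.simps painted_tree.simps binary_cuts_def successively_conv_nth
  by (auto split: if_splits)

lemma binary_cuts_leaf: "binary_cuts (Tree []) C \<longleftrightarrow> C = []"
proof -
  have no_nodes: "nodes (Tree []) = {}"
  proof -
    have "p \<notin> nodes (Tree [])" for p by (cases p) auto
    then show ?thesis by blast
  qed
  moreover have "[] \<in> leaves (Tree [])" by simp
  ultimately have "\<not> is_cut (Tree []) c" for c unfolding is_cut_def by blast
  then show ?thesis using no_nodes unfolding binary_cuts_def by (cases C) auto
qed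

lemma binary_cuts_root_free:
  assumes "[] \<notin> \<Union>(set C)" "ts \<noteq> []"
  shows "binary_cuts (Tree ts) C \<longleftrightarrow>
    length ts = 2 \<and> (\<forall>c\<in>set C. \<forall>p\<in>c. p \<noteq> [] \<and> hd p < length ts) \<and>
    (\<forall>i<length ts. binary_cuts (ts ! i) (map (restrict_child i) C))"
proof -
  have notin: "[] \<notin> c" if "c \<in> set C" for c using assms(1) that by blast
  have cut: "(\<forall>c\<in>set C. is_cut (Tree ts) c) \<longleftrightarrow>
     (\<forall>c\<in>set C. \<forall>p\<in>c. p \<noteq> [] \<and> hd p < length ts) \<and>
     (\<forall>i<length ts. \<forall>c\<in>set C. is_cut (ts ! i) (restrict_child i c))"
    using is_cut_Nil_notin[OF notin assms(2)] by auto
  have below: "successively (cut_below (Tree ts)) C \<longleftrightarrow>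
     (\<forall>i<length ts. successively (cut_below (ts ! i)) (map (restrict_child i) C))"
    unfolding successively_conv_nth
    using cut_below_Nil_notin[OF notin notin assms(2)] by (auto simp: Suc_lessD)
  have "(\<forall>p\<in>nodes (Tree ts). arity (Tree ts) p = (if p \<in> \<Union>(set C) then 1 else 2)) \<longleftrightarrow>
      arity (Tree ts) [] = (if [] \<in> \<Union>(set C) then 1 else 2) \<and>
      (\<forall>i<length ts. \<forall>p\<in>nodes (ts ! i). arity (Tree ts) (i # p) = (if i # p \<in> \<Union>(set C) then 1 else 2))"
    by (rule ball_nodes_Tree[OF assms(2)])
  also have "\<dots> \<longleftrightarrow> length ts = 2 \<and> (\<forall>i<length ts. \<forall>p\<in>nodes (ts ! i).
      arity (ts ! i) p = (if p \<in> \<Union>(set (map (restrict_child i) C)) then 1 else 2))"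
    using assms(1) by simp
  finally have arity: "(\<forall>p\<in>nodes (Tree ts). arity (Tree ts) p = (if p \<in> \<Union>(set C) then 1 else 2)) \<longleftrightarrow> \<dots>" .
  show ?thesis
    unfolding binary_cuts_def cut below arity set_map ball_simps
    by (simp only: imp_conjR all_conj_distrib conj_ac)
qed

text \<open>The root forms a cut by itself and nothing lies above it, so this cut ends the list,
  which runs from the lowest cut upwards. Deleting the root leaves the cuts of its only
  child.\<close>

lemma binary_cuts_root:
  assumes "[] \<in> \<Union>(set C)"
  shows "binary_cuts (Tree ts) C \<longleftrightarrow>
    (\<exists>s C'. ts = [s] \<and> C = C' @ [{[]}] \<and> (\<forall>c\<in>set C'. \<forall>p\<in>c. p \<noteq> [] \<and> hd p = 0) \<and>
       binary_cuts s (map (restrict_child 0) C'))"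
    (is "_ \<longleftrightarrow> ?R")
proof -
  have main: "binary_cuts (Tree [s]) (C' @ [{[]}]) \<longleftrightarrow>
      (\<forall>c\<in>set C'. \<forall>p\<in>c. p \<noteq> [] \<and> hd p = 0) \<and> binary_cuts s (map (restrict_child 0) C')"
    if "[] \<notin> \<Union>(set C')" for s C'
  proof -
    have notin: "[] \<notin> c" if "c \<in> set C'" for c
      using \<open>[] \<notin> \<Union>(set C')\<close> that by blast
    have cut: "(\<forall>c\<in>set (C' @ [{[]}]). is_cut (Tree [s]) c) \<longleftrightarrow>
       (\<forall>c\<in>set C'. \<forall>p\<in>c. p \<noteq> [] \<and> hd p = 0) \<and> (\<forall>c\<in>set C'. is_cut s (restrict_child 0 c))"
      using is_cut_Nil_notin[OF notin, of _ "[s]"] is_cut_Nil_in[of "{[]}" "[s]"] by auto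
    have "successively (cut_below (Tree [s])) C' \<longleftrightarrow>
        successively (cut_below s) (map (restrict_child 0) C')"
      unfolding successively_conv_nth
      using cut_below_Nil_notin[OF notin notin, of _ _ "[s]"] by (auto simp: Suc_lessD)
    moreover have "successively (cut_below (Tree [s])) (C' @ [{[]}]) \<longleftrightarrow>
       successively (cut_below (Tree [s])) C'"
      using notin by (auto simp: successively_append_iff intro!: cut_below_root)
    ultimately have below: "successively (cut_below (Tree [s])) (C' @ [{[]}]) \<longleftrightarrow>
       successively (cut_below s) (map (restrict_child 0) C')" by simp
    have "(\<forall>p\<in>nodes (Tree [s]). arity (Tree [s]) p = (if p \<in> \<Union>(set (C' @ [{[]}])) then 1 else 2)) \<longleftrightarrow>
        arity (Tree [s]) [] = (if [] \<in> \<Union>(set (C' @ [{[]}])) then 1 else 2) \<and>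
        (\<forall>p\<in>nodes s. arity (Tree [s]) (0 # p) = (if 0 # p \<in> \<Union>(set (C' @ [{[]}])) then 1 else 2))"
      by (subst ball_nodes_Tree) simp_all
    also have "\<dots> \<longleftrightarrow> (\<forall>p\<in>nodes s. arity s p = (if p \<in> \<Union>(set (map (restrict_child 0) C')) then 1 else 2))"
      by simp
    finally have arity: "(\<forall>p\<in>nodes (Tree [s]). arity (Tree [s]) p =
        (if p \<in> \<Union>(set (C' @ [{[]}])) then 1 else 2)) \<longleftrightarrow> \<dots>" .
    show ?thesis
      unfolding binary_cuts_def cut below arity set_map ball_simps by (simp only: conj_ac)
  qed
  show ?thesis
  proof
    assume good: "binary_cuts (Tree ts) C"
    obtain c where c: "c \<in> set C" "[] \<in> c" using assms by blast
    then have ne: "ts \<noteq> []" "c = {[]}"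
      using good is_cut_Nil_in[of c ts] by (auto simp: binary_cuts_def)
    have "length ts = 1" using good ne assms by (auto simp: binary_cuts_def dest!: bspec[of _ _ "[]"])
    then obtain s where s: "ts = [s]" by (cases ts) auto
    obtain C' D where C: "C = C' @ c # D" using c(1) by (meson split_list)
    \<comment> \<open>A successor of \<open>{[]}\<close> in the list would need nodes strictly above
      the root.\<close>
    have "D = []"
    proof (cases D)
      case (Cons d D')
      then have "is_cut (Tree ts) d" "cut_below (Tree ts) {[]} d"
        using good C ne by (auto simp: binary_cuts_def successively_append_iff)
      then show ?thesis using not_cut_below_root by blast
    qed
    \<comment> \<open>For the same reason no earlier cut contains the root: it too has a successor
      in \<open>C\<close>.\<close>
    have "[] \<notin> c'" if c': "c' \<in> set C'" for c'
    proof
      assume N: "[] \<in> c'"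
      have "c' = {[]}" using N good is_cut_Nil_in[of c' ts] c' C by (auto simp: binary_cuts_def)
      moreover obtain xs ys where "C' = xs @ c' # ys" using c' by (meson split_list)
      then have "C = xs @ c' # (ys @ c # D)" using C by simp
      then obtain d where "d \<in> set C" "cut_below (Tree ts) c' d"
        using good by (cases ys) (auto simp: binary_cuts_def successively_append_iff)
      ultimately show False using good not_cut_below_root by (auto simp: binary_cuts_def)
    qed
    then have "[] \<notin> \<Union>(set C')" by blast
    from main[OF this] good C s ne \<open>D = []\<close> show ?R by auto
  next
    assume ?R
    then obtain s C' where *: "ts = [s]" "C = C' @ [{[]}]"
      "\<forall>c\<in>set C'. \<forall>p\<in>c. p \<noteq> [] \<and> hd p = 0" "binary_cuts s (map (restrict_child 0) C')" by blast
    then have "[] \<notin> \<Union>(set C')" by blast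
    from main[OF this] * show "binary_cuts (Tree ts) C" by simp
  qed
qed

section \<open>The cuts forced by a tree\<close>

text \<open>\<open>layered m t\<close>: every path from the root of \<open>t\<close> to a leaf meets exactly \<open>m\<close> unary nodes.\<close>

inductive layered :: "nat \<Rightarrow> ptree \<Rightarrow> bool" where
  leaf: "layered 0 (Tree [])"
| unary: "layered m s \<Longrightarrow> layered (Suc m) (Tree [s])"
| binary: "layered m a \<Longrightarrow> layered m b \<Longrightarrow> layered m (Tree [a, b])"

lemma layered_simps [simp]:
  "layered m (Tree []) \<longleftrightarrow> m = 0"
  "layered m (Tree [s]) \<longleftrightarrow> (\<exists>k. m = Suc k \<and> layered k s)"
  "layered m (Tree [a, b]) \<longleftrightarrow> layered m a \<and> layered m b"
  by (subst layered.simps; force)+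

text \<open>In a layered tree, the entry of index \<open>i\<close> consists of the unary nodes with
  exactly \<open>i\<close> unary nodes strictly below them on each path down to a leaf.\<close>

fun cuts :: "ptree \<Rightarrow> nat list set list" where
  "cuts (Tree [s]) = map (image (Cons 0)) (cuts s) @ [{[]}]"
| "cuts (Tree [a, b]) = map2 (\<lambda>c d. Cons 0 ` c \<union> Cons 1 ` d) (cuts a) (cuts b)"
| "cuts _ = []"

lemma length_cuts: "layered m t \<Longrightarrow> length (cuts t) = m"
  by (induction rule: layered.induct) auto

lemma restrict_child_image [simp]:
  "restrict_child i (Cons j ` c) = (if i = j then c else {})"
  "restrict_child i (c \<union> d) = restrict_child i c \<union> restrict_child i d"
  by (auto simp: restrict_child_def)

lemma binary_cuts_cuts: "layered m t \<Longrightarrow> binary_cuts t (cuts t)"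
proof (induction rule: layered.induct)
  case leaf
  show ?case by (simp add: binary_cuts_leaf)
next
  case (unary m s)
  then show ?case
    by (subst binary_cuts_root) (auto simp: comp_def intro!: exI[of _ "map (image (Cons 0)) (cuts s)"])
next
  case (binary m a b)
  have len: "length (cuts a) = length (cuts b)" using binary by (simp add: length_cuts)
  have "map (restrict_child 0) (cuts (Tree [a, b])) = cuts a"
    "map (restrict_child 1) (cuts (Tree [a, b])) = cuts b"
    using len by (auto simp: list_eq_iff_nth_eq)
  moreover have "[] \<notin> \<Union>(set (cuts (Tree [a, b])))"
    "\<forall>c\<in>set (cuts (Tree [a, b])). \<forall>p\<in>c. p \<noteq> [] \<and> hd p < length [a, b]"
    by (auto simp: set_zip)
  ultimately show ?case using binary.IH
    by (subst binary_cuts_root_free) (auto simp: less_Suc_eq simp del: cuts.simps)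
qed

text \<open>Induction through the two root decompositions: the restricted lists are the forced lists
  of the children, and \<open>C\<close> is reassembled from its restrictions.\<close>

lemma binary_cuts_unique: "binary_cuts t C \<Longrightarrow> layered (length C) t \<and> C = cuts t"
proof (induction t arbitrary: C)
  case (Tree ts)
  consider "ts = []" | "ts \<noteq> []" "[] \<in> \<Union>(set C)" | "ts \<noteq> []" "[] \<notin> \<Union>(set C)" by blast
  then show ?case
  proof cases
    case 1
    then show ?thesis using Tree.prems by (simp add: binary_cuts_leaf)
  next
    case 2
    with Tree.prems obtain s C' where *: "ts = [s]" "C = C' @ [{[]}]"
      "\<And>c p. c\<in>set C' \<Longrightarrow> p\<in>c \<Longrightarrow> p \<noteq> [] \<and> hd p = 0" "binary_cuts s (map (restrict_child 0) C')"
      using binary_cuts_root by metis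
    \<comment> \<open>Every address in \<open>c\<close> starts with 0, so restricting and then
      prefixing loses nothing.\<close>
    have "Cons 0 ` restrict_child 0 c = c" if "c \<in> set C'" for c
    proof (rule set_eqI)
      fix p show "p \<in> Cons 0 ` restrict_child 0 c \<longleftrightarrow> p \<in> c" using *(3)[OF that, of p] by (cases p) auto
    qed
    then have "map (image (Cons 0)) (map (restrict_child 0) C') = C'" by (simp add: map_idI)
    moreover have "layered (length C') s" "map (restrict_child 0) C' = cuts s"
      using Tree.IH[OF _ *(4)] *(1) by auto
    ultimately show ?thesis using * by auto
  next
    case 3
    note R = binary_cuts_root_free[OF 3(2) 3(1), THEN iffD1, OF Tree.prems]
    then obtain a b where ts: "ts = [a, b]"
      by (auto simp: numeral_2_eq_2 length_Suc_conv)
    have "(\<forall>i<length ts. Q i) \<longleftrightarrow> Q 0 \<and> Q 1" for Q using ts by (auto simp: less_Suc_eq)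
    with R have "binary_cuts (ts ! 0) (map (restrict_child 0) C)" "binary_cuts (ts ! 1) (map (restrict_child 1) C)"
      by auto
    with Tree.IH ts have *: "layered (length C) a" "map (restrict_child 0) C = cuts a"
      "layered (length C) b" "map (restrict_child 1) C = cuts b"
      by (metis length_map list.set_intros nth_Cons_0 nth_Cons_Suc One_nat_def)+
    have "Cons 0 ` restrict_child 0 c \<union> Cons 1 ` restrict_child 1 c = c" if "c \<in> set C" for c
    proof (rule set_eqI)
      fix p
      have "p \<in> c \<Longrightarrow> p \<noteq> [] \<and> (hd p = 0 \<or> hd p = 1)" using R that ts by fastforce
      then show "p \<in> Cons 0 ` restrict_child 0 c \<union> Cons 1 ` restrict_child 1 c \<longleftrightarrow> p \<in> c" by (cases p) auto
    qed
    then have "map2 (\<lambda>c d. Cons 0 ` c \<union> Cons 1 ` d) (map (restrict_child 0) C) (map (restrict_child 1) C) = C"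
      by (simp add: map2_map_map map_idI)
    with * ts show ?thesis by auto
  qed
qed

lemma binary_cuts_iff: "binary_cuts t C \<longleftrightarrow> layered (length C) t \<and> C = cuts t"
  using binary_cuts_unique binary_cuts_cuts by blast

section \<open>Shadows as words along the right branch\<close>

text \<open>Every subtree has a leaf, so the letter 0 is free to mark unary nodes.\<close>

fun spine :: "ptree \<Rightarrow> nat list" where
  "spine (Tree [s]) = 0 # spine s"
| "spine (Tree [a, b]) = card (leaves a) # spine b"
| "spine _ = []"

text \<open>Cuts are indexed from the lowest, so a unary node on the right branch lies on the cut
  whose index is the number of zeros after it.\<close>

fun labels :: "nat set list \<Rightarrow> nat list \<Rightarrow> nat set list" where
  "labels \<mu> [] = []"
| "labels \<mu> (a # w) = (if a = 0 then \<mu> ! count_list w 0 else {}) # labels \<mu> w"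

lemma count_spine: "layered m t \<Longrightarrow> count_list (spine t) 0 = m"
  by (induction rule: layered.induct) auto

text \<open>Every leaf but the rightmost lies in exactly one left subtree hanging off the right
  branch.\<close>

lemma sum_spine: "layered m t \<Longrightarrow> card (leaves t) = Suc (sum_list (spine t))"
  by (induction rule: layered.induct) auto

text \<open>The root cut is appended at the end, so the cuts of the child keep their
  indices.\<close>

lemma label_at_unary:
  "label_at \<mu> (map (image (Cons 0)) C @ [{[]}]) (0 # p) = label_at \<mu> C p"
  "label_at \<mu> (map (image (Cons 0)) C @ [{[]}]) [] = \<mu> ! length C"
proof -
  let ?C = "map (image (Cons 0)) C @ [{[]}]"
  have "i < length ?C \<and> 0 # p \<in> ?C ! i \<longleftrightarrow> i < length C \<and> p \<in> C ! i" for i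
    by (auto simp: nth_append less_Suc_eq)
  then show "label_at \<mu> ?C (0 # p) = label_at \<mu> C p"
    unfolding label_at_def by (auto intro: image_eqI)
  have "i < length ?C \<and> [] \<in> ?C ! i \<longleftrightarrow> i = length C" for i
    by (auto simp: nth_append less_Suc_eq)
  then show "label_at \<mu> ?C [] = \<mu> ! length C" unfolding label_at_def by auto
qed

lemma label_at_binary:
  assumes "length A = length B"
  shows "label_at \<mu> (map2 (\<lambda>c d. Cons 0 ` c \<union> Cons 1 ` d) A B) (1 # p) = label_at \<mu> B p"
    "label_at \<mu> (map2 (\<lambda>c d. Cons 0 ` c \<union> Cons 1 ` d) A B) [] = {}"
proof -
  let ?C = "map2 (\<lambda>c d. Cons 0 ` c \<union> Cons 1 ` d) A B"
  have eq: "i < length ?C \<and> 1 # p \<in> ?C ! i \<longleftrightarrow> i < length B \<and> p \<in> B ! i" for i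
    using assms by auto
  moreover from this have "1 # p \<in> \<Union>(set ?C) \<longleftrightarrow> p \<in> \<Union>(set B)"
    by (metis (no_types, lifting) Union_iff in_set_conv_nth)
  ultimately show "label_at \<mu> ?C (1 # p) = label_at \<mu> B p" unfolding label_at_def by presburger
  have "[] \<notin> \<Union>(set ?C)" by (auto simp: set_zip)
  then show "label_at \<mu> ?C [] = {}" by (simp add: label_at_def)
qed

lemma shadow_cuts:
  assumes "layered m t"
  shows "shadow (t, cuts t, \<mu>) = (map (\<lambda>a. if a = 0 then [] else [a]) (spine t), labels \<mu> (spine t))"
  using assms
proof (induction rule: layered.induct)
  case leaf
  show ?case by simp
next
  case (unary m s)
  then show ?case by (simp add: comp_def label_at_unary length_cuts count_spine)
next
  case (binary m a b)
  then have "length (cuts a) = length (cuts b)" by (simp add: length_cuts)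
  note label_at_binary[OF this, simplified]
  with binary show ?case by (simp add: comp_def)
qed

text \<open>Read from right to left, the zeros of \<open>w\<close> carry the labels of index 0, 1, 2
  and so on, so each index below their number occurs.\<close>

lemma labels_inj:
  assumes "labels \<mu> w = labels \<mu>' w" "i < count_list w 0"
  shows "\<mu> ! i = \<mu>' ! i"
  using assms by (induction w) (auto simp: less_Suc_eq split: if_splits)

lemma shadow_eq_iff:
  assumes "layered m t" "layered m t'" "length \<mu> = m" "length \<mu>' = m"
  shows "shadow (t, cuts t, \<mu>) = shadow (t', cuts t', \<mu>') \<longleftrightarrow> spine t = spine t' \<and> \<mu> = \<mu>'"
proof -
  have "inj (\<lambda>a::nat. if a = 0 then [] else [a])" by (auto simp: inj_def)
  then have "map (\<lambda>a. if a = 0 then [] else [a]) (spine t) = map (\<lambda>a. if a = 0 then [] else [a]) (spine t')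
    \<longleftrightarrow> spine t = spine t'" by (simp only: inj_map_eq_map)
  moreover have "labels \<mu> (spine t) = labels \<mu>' (spine t) \<longleftrightarrow> \<mu> = \<mu>'"
    using labels_inj[of \<mu> "spine t" \<mu>'] assms by (metis count_spine nth_equalityI)
  ultimately show ?thesis using assms(1,2) by (auto simp only: shadow_cuts prod.inject)
qed

section \<open>Singletons as rigid trees with a free choice of labels\<close>

text \<open>The condition on leaves in the definition of singletons is implied by equality of the spines,
  see \<open>sum_spine\<close>.\<close>

definition rigid :: "nat \<Rightarrow> nat \<Rightarrow> ptree set" where
  "rigid m n = {t. layered m t \<and> card (leaves t) = Suc n \<and>
     (\<forall>t'. layered m t' \<and> spine t' = spine t \<longrightarrow> t' = t)}"

text \<open>The labels can be read off the shadow, so only another tree with the same spine can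
  spoil uniqueness.\<close>

lemma singletons_eq:
  "singletons m n =
    (\<lambda>(t, \<mu>). (t, cuts t, \<mu>)) ` (rigid m n \<times> {\<mu>. length \<mu> = m \<and> ordered_partition {1..m} \<mu>})"
    (is "_ = ?f ` (_ \<times> ?M)")
proof -
  have bin: "binary_painted_tree m n (t, C, \<mu>) \<longleftrightarrow>
      layered m t \<and> C = cuts t \<and> card (leaves t) = Suc n \<and> \<mu> \<in> ?M" for t C \<mu>
    unfolding binary_painted_tree_iff binary_cuts_iff by (auto simp: length_cuts)
  have "(t, C, \<mu>) \<in> singletons m n \<longleftrightarrow> C = cuts t \<and> t \<in> rigid m n \<and> \<mu> \<in> ?M" for t C \<mu>
  proof
    assume L: "(t, C, \<mu>) \<in> singletons m n"
    then have *: "layered m t" "C = cuts t" "card (leaves t) = Suc n" "\<mu> \<in> ?M"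
      unfolding singletons_def mem_Collect_eq bin by blast+
    have "t' = t" if "layered m t'" "spine t' = spine t" for t'
    proof -
      \<comment> \<open>The competitor keeps \<open>\<mu>\<close>; equal spines give equal numbers
        of leaves, so it is again an \<open>n\<close>-tree.\<close>
      have "binary_painted_tree m n (t', cuts t', \<mu>)"
        unfolding bin using that * by (metis sum_spine)
      moreover have "shadow (t', cuts t', \<mu>) = shadow (t, C, \<mu>)"
        using shadow_eq_iff[of m t' t \<mu> \<mu>] that * by blast
      ultimately show ?thesis using L unfolding singletons_def by blast
    qed
    then show "C = cuts t \<and> t \<in> rigid m n \<and> \<mu> \<in> ?M" using * by (auto simp: rigid_def)
  next
    assume R: "C = cuts t \<and> t \<in> rigid m n \<and> \<mu> \<in> ?M"
    have "T' = (t, C, \<mu>)" if "binary_painted_tree m n T'" "shadow T' = shadow (t, C, \<mu>)" for T'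
    proof -
      obtain t' C' \<mu>' where T': "T' = (t', C', \<mu>')" by (cases T')
      with that bin have "layered m t'" "C' = cuts t'" "\<mu>' \<in> ?M" by blast+
      with R that shadow_eq_iff[of m t' t \<mu>' \<mu>] T' show ?thesis unfolding rigid_def by blast
    qed
    moreover have "binary_painted_tree m n (t, C, \<mu>)" using R unfolding bin rigid_def by blast
    ultimately show "(t, C, \<mu>) \<in> singletons m n" unfolding singletons_def by blast
  qed
  then show ?thesis by auto
qed

section \<open>Ordered partitions of \<open>{1..m}\<close> into \<open>m\<close> blocks\<close>

text \<open>The blocks are nonempty and the numbers \<open>card p - 1\<close> sum to
  \<open>card A - card P = 0\<close>.\<close>

lemma partition_on_card_eq:
  assumes "partition_on A P" "finite A" "card P = card A"
  shows "P = (\<lambda>x. {x}) ` A"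
proof -
  have fin: "finite P" "\<And>p. p \<in> P \<Longrightarrow> finite p"
    using finite_elements[OF assms(2,1)] assms(2) partition_onD1[OF assms(1)]
    by (auto intro: finite_subset[OF Union_upper])
  have pos: "card p \<ge> 1" if "p \<in> P" for p
    using fin(2)[OF that] partition_onD3[OF assms(1)] that by (auto simp: Suc_le_eq card_gt_0_iff)
  have "card A = (\<Sum>p\<in>P. card p)" using product_partition[OF assms(1) fin(2)] by simp
  then have "(\<Sum>p\<in>P. card p - 1) = 0"
    using sum_subtractf_nat[of P "\<lambda>_. 1" card] pos assms(3) by simp
  then have "\<forall>p\<in>P. card p - 1 = 0" using fin(1) by (simp only: sum_eq_0_iff)
  then have one: "card p = 1" if "p \<in> P" for p using that pos by (metis le_antisym diff_is_0_eq)
  have "P \<subseteq> (\<lambda>x. {x}) ` A"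
  proof
    fix p assume p: "p \<in> P"
    then obtain x where "p = {x}" using one card_1_singletonE by metis
    then show "p \<in> (\<lambda>x. {x}) ` A" using p partition_onD1[OF assms(1)] by blast
  qed
  then show ?thesis using assms(2,3) by (intro card_subset_eq) (auto simp: card_image)
qed

lemma partition_on_singletons: "partition_on A ((\<lambda>x. {x}) ` A)"
  by (auto simp: partition_on_def disjoint_def)

text \<open>All \<open>m\<close> blocks have one element, so the lists are the orderings of these
  \<open>m\<close> blocks.\<close>

lemma card_ordered_partitions:
  "card {\<mu>. length \<mu> = m \<and> ordered_partition {1..m} \<mu>} = fact m"
proof -
  let ?S = "(\<lambda>x. {x}) ` {1..m}"
  have S: "card ?S = m" by (simp add: card_image)
  have "set \<mu> = ?S" if "length \<mu> = m" "ordered_partition {1..m} \<mu>" for \<mu>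
    using that partition_on_card_eq[of "{1..m}" "set \<mu>"]
    by (auto simp: ordered_partition_def distinct_card)
  moreover have "length \<mu> = m" "ordered_partition {1..m} \<mu>" if "set \<mu> = ?S" "distinct \<mu>" for \<mu>
    using that S partition_on_singletons distinct_card by (metis, metis ordered_partition_def)
  ultimately have "{\<mu>. length \<mu> = m \<and> ordered_partition {1..m} \<mu>} = permutations_of_set ?S"
    unfolding permutations_of_set_def by (intro Collect_cong) (metis ordered_partition_def)
  then show ?thesis using S by simp
qed

section \<open>Classification of rigid trees\<close>

lemma layered_cases:
  assumes "layered m t"
  obtains "m = 0" "t = Tree []"
  | k s where "m = Suc k" "t = Tree [s]" "layered k s"
  | a b where "t = Tree [a, b]" "layered m a" "layered m b"
  using assms by (cases rule: layered.cases) auto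

fun path :: "nat \<Rightarrow> ptree" where
  "path 0 = Tree []"
| "path (Suc m) = Tree [path m]"

abbreviation cherry :: ptree where
  "cherry \<equiv> Tree [Tree [], Tree []]"

lemma layered_path [simp]: "layered m (path m)"
  and card_leaves_path [simp]: "card (leaves (path m)) = 1"
  by (induction m) auto

lemma layered_one_leaf: "layered m t \<Longrightarrow> card (leaves t) = 1 \<Longrightarrow> t = path m"
proof (induction rule: layered.induct)
  case (binary m a b)
  then show ?case using card_leaves_pos[of a] card_leaves_pos[of b] by simp
qed auto

lemma layered_two_leaves: "layered 0 t \<Longrightarrow> card (leaves t) = 2 \<Longrightarrow> t = cherry"
proof (erule layered_cases)
  fix a b assume "card (leaves t) = 2" "t = Tree [a, b]" "layered 0 a" "layered 0 b"
  moreover from this have "card (leaves a) = 1" "card (leaves b) = 1"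
    using card_leaves_pos[of a] card_leaves_pos[of b] unfolding \<open>t = _\<close> card_leaves_simps by linarith+
  ultimately show "t = cherry" using layered_one_leaf[of 0] by auto
qed auto

lemma layered_exists: "\<exists>t. layered m t \<and> card (leaves t) = Suc n"
proof (induction n)
  case 0
  then show ?case by (intro exI[of _ "path m"]) simp
next
  case (Suc n)
  then obtain t where "layered m t \<and> card (leaves t) = Suc n" by blast
  then show ?case by (intro exI[of _ "Tree [path m, t]"]) simp
qed

text \<open>Meant for left subtrees, of which the spine records only the number of leaves. Outside
  the listed cases, two visibly different trees share both parameters.\<close>

lemma layered_unique_iff:
  assumes "layered m a"
  shows "(\<forall>a'. layered m a' \<and> card (leaves a') = card (leaves a) \<longrightarrow> a' = a) \<longleftrightarrow>
    a = path m \<or> m = 0 \<and> a = cherry"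
    (is "?U \<longleftrightarrow> ?R")
proof
  assume U: ?U
  obtain n where n: "card (leaves a) = Suc n" using card_leaves_pos[of a] by (metis gr0_implies_Suc)
  consider "n = 0" | "n = 1" "m = 0" | k where "n = Suc (Suc k)" "m = 0" | k j where "n = Suc k" "m = Suc j"
    by (metis One_nat_def old.nat.exhaust)
  then show ?R
  proof cases
    case 1
    then show ?thesis using layered_one_leaf[OF assms] n by simp
  next
    case 2
    then show ?thesis using layered_two_leaves assms n by simp
  next
    case 3
    obtain t t' where "layered 0 t" "card (leaves t) = Suc k" "layered 0 t'" "card (leaves t') = Suc (Suc k)"
      using layered_exists by metis
    \<comment> \<open>Both trees have \<open>k + 3\<close> leaves but different left subtrees, so
      \<open>a\<close> cannot equal both.\<close>
    then have "Tree [cherry, t] = a" "Tree [Tree [], t'] = a" using U n 3 by auto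
    then show ?thesis by auto
  next
    case 4
    obtain t t' where "layered j t" "card (leaves t) = Suc (Suc k)" "layered m t'" "card (leaves t') = Suc k"
      using layered_exists by metis
    \<comment> \<open>Both trees have \<open>k + 2\<close> leaves, but one root is unary and the
      other binary.\<close>
    then have "Tree [t] = a" "Tree [path m, t'] = a" using U n 4 by auto
    then show ?thesis by auto
  qed
next
  assume ?R
  then show ?U using layered_one_leaf layered_two_leaves by auto
qed

lemma rigid_leaf: "Tree [] \<in> rigid m n \<longleftrightarrow> m = 0 \<and> n = 0"
  by (auto simp: rigid_def elim: layered_cases)

text \<open>The leading 0 of the spine forces a unary root on every competitor, so the comparison
  passes to the child.\<close>

lemma rigid_unary: "Tree [s] \<in> rigid m n \<longleftrightarrow> (\<exists>k. m = Suc k \<and> s \<in> rigid k n)"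
proof -
  have "t' \<in> range (\<lambda>s. Tree [s])" if "layered m t'" "spine t' = spine (Tree [s])" for t'
    using that(1)
  proof (cases rule: layered_cases)
    case (3 a b)
    then show ?thesis using that(2) card_leaves_pos[of a] by simp
  qed (use that in auto)
  note shape = this
  have "(\<forall>t'. layered m t' \<and> spine t' = spine (Tree [s]) \<longrightarrow> t' = Tree [s]) \<longleftrightarrow>
    (\<forall>s'. layered m (Tree [s']) \<and> spine s' = spine s \<longrightarrow> s' = s)" (is "?l \<longleftrightarrow> ?r")
  proof
    assume ?l
    show ?r
    proof safe
      fix s' assume "layered m (Tree [s'])" "spine s' = spine s"
      then show "s' = s" using \<open>?l\<close>[rule_format, of "Tree [s']"] by simp
    qed
  next
    assume ?r
    show ?l
    proof safe
      fix t' assume t': "layered m t'" "spine t' = spine (Tree [s])"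
      with shape obtain s' where "t' = Tree [s']" by blast
      with t' show "t' = Tree [s]" using \<open>?r\<close>[rule_format, of s'] by simp
    qed
  qed
  then show ?thesis unfolding rigid_def by auto
qed

text \<open>The spine keeps the number of leaves of \<open>a\<close> and the whole spine of
  \<open>b\<close>, so the two subtrees can be exchanged independently: \<open>a\<close> falls under
  \<open>layered_unique_iff\<close>, and \<open>b\<close> must be rigid.\<close>

lemma rigid_binary:
  "Tree [a, b] \<in> rigid m n \<longleftrightarrow>
    (a = path m \<or> m = 0 \<and> a = cherry) \<and> (\<exists>k. n = card (leaves a) + k \<and> b \<in> rigid m k)"
proof (cases "layered m a \<and> layered m b")
  case True
  have shape: "\<exists>a' b'. t' = Tree [a', b']" if "layered m t'" "spine t' = spine (Tree [a, b])" for t'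
    using that(1)
  proof (cases rule: layered_cases)
    case (2 k s)
    then show ?thesis using that(2) card_leaves_pos[of a] by simp
  qed (use that in auto)
  have "(\<forall>t'. layered m t' \<and> spine t' = spine (Tree [a, b]) \<longrightarrow> t' = Tree [a, b]) \<longleftrightarrow>
    (\<forall>a' b'. layered m a' \<and> layered m b' \<and> card (leaves a') = card (leaves a) \<and> spine b' = spine b
        \<longrightarrow> a' = a \<and> b' = b)" (is "?l \<longleftrightarrow> ?r")
  proof
    assume ?l
    then show ?r by (metis layered_simps(3) list.inject ptree.inject spine.simps(2))
  next
    assume r: ?r
    show ?l
    proof safe
      fix t' assume t': "layered m t'" "spine t' = spine (Tree [a, b])"
      with shape obtain a' b' where "t' = Tree [a', b']" by blast
      with t' r show "t' = Tree [a, b]" by (metis layered_simps(3) list.inject spine.simps(2))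
    qed
  qed
  also have "\<dots> \<longleftrightarrow> (\<forall>a'. layered m a' \<and> card (leaves a') = card (leaves a) \<longrightarrow> a' = a) \<and>
     (\<forall>b'. layered m b' \<and> spine b' = spine b \<longrightarrow> b' = b)"
    using True by blast
  also have "\<dots> \<longleftrightarrow> (a = path m \<or> m = 0 \<and> a = cherry) \<and>
     (\<forall>b'. layered m b' \<and> spine b' = spine b \<longrightarrow> b' = b)"
    using layered_unique_iff True by simp
  finally have "Tree [a, b] \<in> rigid m n \<longleftrightarrow> card (leaves a) + card (leaves b) = Suc n \<and>
     (a = path m \<or> m = 0 \<and> a = cherry) \<and> (\<forall>b'. layered m b' \<and> spine b' = spine b \<longrightarrow> b' = b)"
    using True by (simp add: rigid_def)
  \<comment> \<open>A tree in \<open>rigid m k\<close> has \<open>k + 1\<close> leaves, hence the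
    witness \<open>card (leaves b) - 1\<close>.\<close>
  moreover have "card (leaves a) + card (leaves b) = Suc n \<longleftrightarrow>
      (\<exists>k. n = card (leaves a) + k \<and> card (leaves b) = Suc k)"
    using card_leaves_pos[of b] by (auto intro!: exI[of _ "card (leaves b) - 1"])
  ultimately show ?thesis using True unfolding rigid_def by blast
next
  case False
  then have "\<not> ((a = path m \<or> m = 0 \<and> a = cherry) \<and> layered m b)" by auto
  then show ?thesis using False by (auto simp: rigid_def)
qed

lemma rigid_cases:
  assumes "t \<in> rigid m n"
  obtains "t = Tree []" | s where "t = Tree [s]" | a b where "t = Tree [a, b]"
  using assms unfolding rigid_def by (auto elim: layered_cases)

lemma rigid_iff:
  "t \<in> rigid m n \<longleftrightarrow> t = Tree [] \<and> m = 0 \<and> n = 0 \<or>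
    (\<exists>k s. t = Tree [s] \<and> m = Suc k \<and> s \<in> rigid k n) \<or>
    (\<exists>a b k. t = Tree [a, b] \<and> (a = path m \<or> m = 0 \<and> a = cherry) \<and>
       n = card (leaves a) + k \<and> b \<in> rigid m k)"
  (is "_ \<longleftrightarrow> ?R")
proof
  assume t: "t \<in> rigid m n"
  then show ?R
    by (cases rule: rigid_cases) (use t in \<open>auto simp: rigid_leaf rigid_unary rigid_binary\<close>)
next
  assume ?R
  then show "t \<in> rigid m n" by (auto simp: rigid_leaf rigid_unary rigid_binary)
qed

section \<open>Counting rigid trees\<close>

lemma rigid_0_0: "rigid 0 0 = {Tree []}"
  by (rule set_eqI, subst rigid_iff) auto

lemma rigid_0_1: "rigid 0 (Suc 0) = (\<lambda>b. Tree [Tree [], b]) ` rigid 0 0"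
  by (rule set_eqI, subst rigid_iff) auto

text \<open>A leaf on the left lowers \<open>n\<close> by one and a cherry by two, which is the
  Fibonacci recurrence.\<close>

lemma rigid_0_Suc_Suc:
  "rigid 0 (Suc (Suc n)) = (\<lambda>b. Tree [Tree [], b]) ` rigid 0 (Suc n) \<union> (\<lambda>b. Tree [cherry, b]) ` rigid 0 n"
  by (rule set_eqI, subst rigid_iff) auto

lemma rigid_Suc_0: "rigid (Suc m) 0 = (\<lambda>s. Tree [s]) ` rigid m 0"
  by (rule set_eqI, subst rigid_iff) (auto simp del: path.simps)

text \<open>With at least one cut, a cherry is excluded: a unary root lowers the number of cuts, and
  a binary root has a path on its left and lowers \<open>n\<close> by one.\<close>

lemma rigid_Suc_Suc:
  "rigid (Suc m) (Suc n) =
    (\<lambda>s. Tree [s]) ` rigid m (Suc n) \<union> (\<lambda>b. Tree [path (Suc m), b]) ` rigid (Suc m) n"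
  by (rule set_eqI, subst rigid_iff) (auto simp del: path.simps)

lemma rigid_0: "finite (rigid 0 n) \<and> card (rigid 0 n) = fib (Suc n)"
proof (induction n rule: fib.induct)
  case (3 n)
  then show ?case unfolding rigid_0_Suc_Suc
    by (subst card_Un_disjoint) (auto simp: card_image inj_on_def)
qed (auto simp: rigid_0_0 rigid_0_1 card_image)

text \<open>Truncated subtraction agrees with the convention for \<open>m = 0\<close>: the
  coefficient is \<open>0 choose 0 = 1\<close> at \<open>k = 0\<close> and
  \<open>(k - 1) choose k = 0\<close> for \<open>k \<ge> 1\<close>.\<close>

definition rigid_count :: "nat \<Rightarrow> nat \<Rightarrow> nat" where
  "rigid_count m n = (\<Sum>k = 0..n. ((m + k - 1) choose k) * fib (n - k + 1))"

lemma rigid_count_0: "rigid_count 0 n = fib (Suc n)"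
proof -
  have "rigid_count 0 n = (\<Sum>k = 0..n. if k = 0 then fib (Suc n) else 0)"
    unfolding rigid_count_def by (intro sum.cong) auto
  then show ?thesis by simp
qed

lemma rigid_count_Suc_0: "rigid_count (Suc m) 0 = rigid_count m 0"
  by (simp add: rigid_count_def)

text \<open>After the summand \<open>k = 0\<close> is split off, Pascal's rule divides
  \<open>(m + k + 1) choose (k + 1)\<close> into \<open>(m + k) choose k\<close>, which yields
  \<open>rigid_count (Suc m) n\<close>, and \<open>(m + k) choose (k + 1)\<close>, which with the
  split summand yields \<open>rigid_count m (Suc n)\<close>.\<close>

lemma rigid_count_Suc_Suc:
  "rigid_count (Suc m) (Suc n) = rigid_count m (Suc n) + rigid_count (Suc m) n"
  unfolding rigid_count_def sum.atLeast0_atMost_Suc_shift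
  by (simp add: sum.distrib algebra_simps)

text \<open>Induction on \<open>m\<close> and, inside, on \<open>n\<close>; the two images in the
  recurrence are disjoint because the root arities differ.\<close>

lemma card_rigid: "finite (rigid m n) \<and> card (rigid m n) = rigid_count m n"
proof (induction m arbitrary: n)
  case 0
  then show ?case by (simp add: rigid_0 rigid_count_0)
next
  case (Suc m)
  note IH = Suc
  show ?case
  proof (induction n)
    case 0
    then show ?case using IH by (simp add: rigid_Suc_0 rigid_count_Suc_0 card_image inj_on_def)
  next
    case (Suc n)
    then show ?case using IH unfolding rigid_Suc_Suc rigid_count_Suc_Suc
      by (subst card_Un_disjoint) (auto simp: card_image inj_on_def)
  qed
qed

theorem corollary45:
  fixes m n :: nat
  shows "card (singletons m n) =
    fact m * (\<Sum>k = 0..n. ((m + k - 1) choose k) * fib (n - k + 1))"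
proof -
  \<comment> \<open>Inserting \<open>cuts t\<close> leaves \<open>t\<close> and \<open>\<mu>\<close>
    visible, so the singletons are counted by the product of the numbers of trees and of
    labellings.\<close>
  have "inj_on (\<lambda>(t, \<mu>). (t, cuts t, \<mu>)) A" for A :: "(ptree \<times> nat set list) set"
    by (auto simp: inj_on_def)
  then show ?thesis
    unfolding singletons_eq using card_rigid[of m n]
    by (simp only: card_image card_cartesian_product card_ordered_partitions rigid_count_def mult.commute)
qed

end
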